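(* For every sequence $\{q_n\}_{n\ge 1}$ of positive real numbers, the inequality $$q_{n}\, p_{n+1}-q_{n+1}\, p_{n}<p_{n}$$ holds for infinitely many (hence arbitrarily large) values of $n$.
   Context: $p_n$ denotes the $n$th prime number ($p_1=2$, $p_2=3$, ...). *)

theory Defs
  imports
    "HOL-Analysis.Analysis"
    "HOL-Computational_Algebra.Primes"
    "HOL-Library.Infinite_Set"
begin

text \<open>
  The primes are indexed from 1, whereas \<^const>\<open>enumerate\<close> starts at 0. The value at
  index 0 is an artefact of truncated subtraction and carries no meaning.
\<close>

definition nth_prime :: "nat \<Rightarrow> nat" where
  "nth_prime n = enumerate {p::nat. prime p} (n - 1)"

end

(*
  If the inequality failed from some index on, dividing by p_n p_(n+1) would give
  q_n / p_n - q_(n+1) / p_(n+1) >= 1 / p_(n+1). Telescoping bounds the partial sums of the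
  reciprocals of the primes by a value of q_n / p_n, but these reciprocals have a divergent sum.

  For the divergence, write every n <= N as a squarefree number times a square. Then the
  harmonic sum up to N is at most C * (product of 1 + 1/p over primes p <= N), where C is the
  sum of 1/k^2, hence at most C * exp (sum of 1/p over primes p <= N).
*)
theory Submission
  imports Defs "HOL-Computational_Algebra.Squarefree"
begin

lemma squarefree_nat_eq_prod_prime_factors:
  fixes n :: nat
  assumes "squarefree n"
  shows "n = \<Prod>(prime_factors n)"
proof -
  have "n \<noteq> 0"
    using assms by (auto intro: Nat.gr0I)
  then have "n = (\<Prod>p\<in>prime_factors n. p ^ multiplicity p n)"
    by (simp add: prime_factorization_nat)
  also have "\<dots> = \<Prod>(prime_factors n)"
    using assms \<open>n \<noteq> 0\<close> by (intro prod.cong) (auto simp: squarefree_factorial_semiring')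
  finally show ?thesis .
qed

text \<open>A squarefree number is the product of its prime factors. The case \<open>n = 0\<close>
  is covered because its square part is 0 and \<open>inverse 0 = 0\<close>.\<close>

lemma inverse_eq_squarefree_part_square_part:
  fixes n :: nat
  shows "inverse (real n) =
    (\<Prod>p\<in>prime_factors (squarefree_part n). inverse (real p)) * inverse (real (square_part n) ^ 2)"
proof -
  have "n = \<Prod>(prime_factors (squarefree_part n)) * square_part n ^ 2"
    using squarefree_decompose[of n]
      squarefree_nat_eq_prod_prime_factors[OF squarefree_squarefree_part[of n]] by metis
  from arg_cong[OF this, of "\<lambda>n. inverse (real n)"] show ?thesis
    by (simp add: prod_inversef[symmetric] o_def)
qed

text \<open>Expanding the right-hand side gives one term for each pair of a set of primes up to
  \<open>N\<close> and a number \<open>k\<close> in \<open>{1..N}\<close>. Each \<open>n\<close> up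
  to \<open>N\<close> accounts for a different such term, whose value is \<open>1/n\<close>.\<close>

lemma harmonic_sum_le_prod_primes:
  "(\<Sum>n=1..N. inverse (real n)) \<le>
    (\<Prod>p\<in>{p. prime p \<and> p \<le> N}. 1 + inverse (real p)) * (\<Sum>k=1..N. inverse (real k ^ 2))"
proof -
  define A where "A = {p::nat. prime p \<and> p \<le> N}"
  have finA: "finite A"
    unfolding A_def by simp
  define \<phi> :: "nat \<Rightarrow> nat set \<times> nat"
    where "\<phi> n = (prime_factors (squarefree_part n), square_part n)" for n
  \<comment> \<open>The weight is chosen so that \<open>w (\<phi> n) = 1/n\<close>.\<close>
  define w :: "nat set \<times> nat \<Rightarrow> real"
    where "w = (\<lambda>(S, k). (\<Prod>p\<in>S. inverse (real p)) * inverse (real k ^ 2))"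
  have inj: "inj_on \<phi> {1..N}"
    unfolding inj_on_def \<phi>_def
    by (metis prod.inject squarefree_decomposition_unique squarefree_nat_eq_prod_prime_factors
        squarefree_squarefree_part)
  \<comment> \<open>The square part of \<open>n\<close> and the primes of its squarefree part are
    divisors of \<open>n\<close>, hence at most \<open>N\<close>.\<close>
  have sub: "\<phi> ` {1..N} \<subseteq> Pow A \<times> {1..N}"
  proof
    fix x assume "x \<in> \<phi> ` {1..N}"
    then obtain n where n: "1 \<le> n" "n \<le> N" and x: "x = \<phi> n"
      by auto
    have "square_part n dvd n" "squarefree_part n dvd n"
      using squarefree_decompose[of n] by (metis dvd_def dvd_mult power2_eq_square, metis dvd_def)
    moreover from this have "p dvd n" if "p \<in> prime_factors (squarefree_part n)" for p
      using that by (meson dvd_trans in_prime_factors_imp_dvd)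
    moreover have "d \<in> {1..N}" if "d dvd n" for d
      using that n dvd_imp_le[OF that] by (cases d) auto
    ultimately have "square_part n \<in> {1..N}"
        "\<And>p. p \<in> prime_factors (squarefree_part n) \<Longrightarrow> p \<le> N"
      by fastforce+
    then show "x \<in> Pow A \<times> {1..N}"
      using x by (auto simp: \<phi>_def A_def)
  qed
  have "(\<Sum>n=1..N. inverse (real n)) = (\<Sum>n=1..N. w (\<phi> n))"
    by (simp add: w_def \<phi>_def flip: inverse_eq_squarefree_part_square_part)
  also have "\<dots> = sum w (\<phi> ` {1..N})"
    by (simp only: sum.reindex[OF inj] o_def)
  also have "\<dots> \<le> sum w (Pow A \<times> {1..N})"
    using finA sub by (intro sum_mono2) (auto simp: w_def intro!: mult_nonneg_nonneg prod_nonneg)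
  also have "\<dots> = (\<Sum>S\<in>Pow A. \<Prod>p\<in>S. inverse (real p)) * (\<Sum>k=1..N. inverse (real k ^ 2))"
    by (simp add: w_def sum_product sum.cartesian_product)
  \<comment> \<open>Multiplying out the product, \<open>S\<close> collects the primes whose factor
    contributes \<open>1/p\<close> instead of 1.\<close>
  also have "(\<Sum>S\<in>Pow A. \<Prod>p\<in>S. inverse (real p)) = (\<Prod>p\<in>A. 1 + inverse (real p))"
    using prod_add[OF finA, of "\<lambda>p. inverse (real p)" "\<lambda>_. 1"] by (simp add: add.commute)
  finally show ?thesis
    by (simp add: A_def)
qed

lemma not_summable_on_inverse_primes:
  "\<not> (\<lambda>p. inverse (real p)) summable_on {p. prime p}"
proof
  assume sm: "(\<lambda>p. inverse (real p)) summable_on {p. prime p}"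
  define s where "s = (\<Sum>\<^sub>\<infinity>p\<in>{p. prime p}. inverse (real p))"
  define C where "C = (\<Sum>k. inverse (real k ^ 2))"
  have "(\<Sum>n<N. inverse (real n)) \<le> exp s * C" for N
  proof -
    have "(\<Sum>n<N. inverse (real n)) \<le> (\<Sum>n=0..N. inverse (real n))"
      by (intro sum_mono2) auto
    \<comment> \<open>The index 0 contributes \<open>inverse 0 = 0\<close>.\<close>
    also have "\<dots> = (\<Sum>n=1..N. inverse (real n))"
      by (intro sum.mono_neutral_right) auto
    also have "\<dots> \<le> (\<Prod>p\<in>{p. prime p \<and> p \<le> N}. 1 + inverse (real p)) *
        (\<Sum>k=1..N. inverse (real k ^ 2))"
      by (rule harmonic_sum_le_prod_primes)
    also have "\<dots> \<le> exp s * C"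
    proof (intro mult_mono)
      have "(\<Prod>p\<in>{p. prime p \<and> p \<le> N}. 1 + inverse (real p)) \<le>
          (\<Prod>p\<in>{p. prime p \<and> p \<le> N}. exp (inverse (real p)))"
        by (intro prod_mono) (auto simp: exp_ge_add_one_self)
      also have "\<dots> = exp (\<Sum>p\<in>{p. prime p \<and> p \<le> N}. inverse (real p))"
        by (simp add: exp_sum)
      also have "\<dots> \<le> exp s"
        unfolding s_def exp_le_cancel_iff using sm by (intro finite_sum_le_infsum) auto
      finally show "(\<Prod>p\<in>{p. prime p \<and> p \<le> N}. 1 + inverse (real p)) \<le> exp s" .
      show "(\<Sum>k=1..N. inverse (real k ^ 2)) \<le> C"
        unfolding C_def by (intro sum_le_suminf inverse_power_summable) auto
    qed (auto intro: sum_nonneg)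
    finally show ?thesis .
  qed
  then have "summable (\<lambda>n. inverse (real n))"
    by (intro summableI_nonneg_bounded) auto
  then show False
    using not_summable_harmonic by blast
qed

text \<open>The enumeration is a bijection onto the primes, and for nonnegative terms summability
  does not depend on the order. \<open>Suc n\<close> skips the meaningless index 0.\<close>

lemma not_summable_inverse_nth_prime: "\<not> summable (\<lambda>n. inverse (real (nth_prime (Suc n))))"
proof
  assume "summable (\<lambda>n. inverse (real (nth_prime (Suc n))))"
  then have "(\<lambda>n. inverse (real (enumerate {p::nat. prime p} n))) summable_on UNIV"
    by (simp add: nth_prime_def summable_on_UNIV_nonneg_real_iff)
  then have "(\<lambda>p. inverse (real p)) summable_on {p. prime p}"
    using summable_on_reindex_bij_betw[OF bij_enumerate[OF primes_infinite],
        of "\<lambda>p. inverse (real p)"] by simp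
  then show False
    using not_summable_on_inverse_primes by simp
qed

lemma nth_prime_pos: "0 < nth_prime n"
  using enumerate_in_set[OF primes_infinite, of "n - 1"] by (simp add: nth_prime_def prime_gt_0_nat)

theorem theorem1:
  fixes q :: "nat \<Rightarrow> real"
  assumes "\<And>n. n \<ge> 1 \<Longrightarrow> q n > 0"
  shows "infinite {n::nat. n \<ge> 1 \<and>
           q n * real (nth_prime (n + 1)) - q (n + 1) * real (nth_prime n) < real (nth_prime n)}"
proof
  let ?p = "\<lambda>n. real (nth_prime n)"
  assume "finite {n::nat. n \<ge> 1 \<and> q n * ?p (n + 1) - q (n + 1) * ?p n < ?p n}"
  then obtain M where M: "\<And>n. n \<ge> 1 \<and> q n * ?p (n + 1) - q (n + 1) * ?p n < ?p n \<Longrightarrow> n \<le> M"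
    unfolding finite_nat_set_iff_bounded_le by auto
  \<comment> \<open>From \<open>N\<close> on, the inequality fails and the index is at least 1, so
    that \<open>q\<close> is positive there.\<close>
  define N where "N = Suc M"
  define r where "r n = q n / ?p n" for n
  have step: "inverse (?p (Suc n)) \<le> r n - r (Suc n)" if "n \<ge> N" for n
  proof -
    have "q n * ?p (n + 1) - q (n + 1) * ?p n \<ge> ?p n"
      using M[of n] that by (force simp: N_def)
    then show ?thesis
      using nth_prime_pos[of n] nth_prime_pos[of "Suc n"] by (simp add: r_def field_simps)
  qed
  have "(\<Sum>k<m. inverse (?p (Suc (k + N)))) \<le> r N" for m
  proof -
    have "(\<Sum>k<m. inverse (?p (Suc (k + N)))) \<le> (\<Sum>k<m. r (k + N) - r (Suc k + N))"
      by (intro sum_mono) (use step in simp)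
    also have "\<dots> = r N - r (m + N)"
      by (subst sum_lessThan_telescope') simp
    \<comment> \<open>Positivity of \<open>q\<close> allows the last telescoped term to be dropped,
      which leaves a bound independent of \<open>m\<close>.\<close>
    also have "\<dots> \<le> r N"
      using assms[of "m + N"] by (simp add: r_def N_def)
    finally show ?thesis .
  qed
  then have "summable (\<lambda>k. inverse (?p (Suc (k + N))))"
    by (intro summableI_nonneg_bounded) auto
  then show False
    using not_summable_inverse_nth_prime summable_iff_shift[of "\<lambda>n. inverse (?p (Suc n))" N] by simp
qed

end
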